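(* Let $T$ be a tree with a fixed vertex $x_0$ and heat kernel $p_t$, and let $T_n$ be a model tree with branching function $n(r)$ and radial heat kernel $\rho_t(r)$. Let $\underline{m}(r)=\min_{x\in S_r(x_0)}m(x)$, where $S_r(x_0)$ is the sphere in $T$ and $m(x)$ is the valence in $T$. If $$n(r)\le\underline{m}(r)-1\quad\text{for all } r>0,$$ then $$p_t(x_0,x)\le\rho_t(r)$$ for all $x\in S_r(x_0)\subset T$.
   Context: All graphs are infinite, locally finite and connected; $d(x,y)$ is the number of edges in a shortest path from $x$ to $y$, $m(x)$ is the valence (number of edges at $x$), $y\sim x$ means $x,y$ are joined by an edge, and $S_r(x_0)=\{x: d(x,x_0)=r\}$. A tree is called model if it contains a vertex, the root, such that the valence is constant, say equal to $m(r)$, on each sphere of radius $r$ about the root. Its branching function is $n(r)=m(r)-1$ for $r>0$, and $n(0)=m(0)$ is the valence of the root; the tree is denoted $T_n$. The root of $T_n$ is also denoted $x_0$. The combinatorial Laplacian is $\Delta f(x)=\sum_{y\sim x}(f(x)-f(y))$. The heat kernel $p_t(x,y)$ of a graph with vertex set $V$ is the smallest non-negative function on $V\times V\times[0,\infty)$ which is smooth in $t$, satisfies $\Delta p+\frac{\partial p}{\partial t}=0$ (with $\Delta$ in either vertex variable) and $p_0(x,y)=\delta_x(y)$, where $\delta_x(y)=1$ if $x=y$ and $0$ otherwise. On $T_n$ the heat kernel from the root to a vertex depends only on the distance of that vertex from the root; $\rho_t(r)$ denotes the common value at time $t$ of the heat kernel of $T_n$ between the root and the vertices at distance $r$ from the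 root.
   Formalization: The additional hypothesis n(0) ≤ m(x_0) (root valence of the model tree at most the valence of x_0) is assumed; without it the claim fails at r = 0 for small t, e.g. T the two-way infinite path and T_n three rays glued at the root. *)

theory Defs
  imports "HOL-Analysis.Analysis"
begin

text \<open>
  A graph is a symmetric irreflexive adjacency relation; its vertex set is the whole type.
\<close>

definition valence :: "('a \<Rightarrow> 'a \<Rightarrow> bool) \<Rightarrow> 'a \<Rightarrow> nat" where
  "valence E x = card {y. E x y}"

text \<open>
  The relation \<open>(E ^^ k) x y\<close> says that some walk with \<open>k\<close> edges leads from \<open>x\<close> to \<open>y\<close>; a walk of
  least length is a path, so in a connected graph the following is the number of edges in a
  shortest path.
\<close>

definition graph_dist :: "('a \<Rightarrow> 'a \<Rightarrow> bool) \<Rightarrow> 'a \<Rightarrow> 'a \<Rightarrow> nat" where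
  "graph_dist E x y = (LEAST k. (E ^^ k) x y)"

definition graph_sphere :: "('a \<Rightarrow> 'a \<Rightarrow> bool) \<Rightarrow> 'a \<Rightarrow> nat \<Rightarrow> 'a set" where
  "graph_sphere E x0 r = {x. graph_dist E x x0 = r}"

definition min_valence :: "('a \<Rightarrow> 'a \<Rightarrow> bool) \<Rightarrow> 'a \<Rightarrow> nat \<Rightarrow> nat" where
  "min_valence E x0 r = Min (valence E ` graph_sphere E x0 r)"

definition graph_cycle :: "('a \<Rightarrow> 'a \<Rightarrow> bool) \<Rightarrow> 'a list \<Rightarrow> bool" where
  "graph_cycle E xs \<longleftrightarrow>
     3 \<le> length xs \<and> distinct xs \<and> successively E xs \<and> E (last xs) (hd xs)"

locale infinite_graph =
  fixes E :: "'a \<Rightarrow> 'a \<Rightarrow> bool"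
  assumes symmetric: "symp E"
    and loopfree: "irreflp E"
    and infinite_vertices: "infinite (UNIV :: 'a set)"
    and locally_finite: "\<And>x. finite {y. E x y}"
    and connected: "\<And>x y. E\<^sup>*\<^sup>* x y"

locale infinite_tree = infinite_graph +
  assumes no_cycle: "\<And>xs. \<not> graph_cycle E xs"

text \<open>
  \<open>n\<close> is the branching function: the valence is \<open>n r + 1\<close> on the sphere of radius \<open>r > 0\<close>
  about the root \<open>y0\<close>, while \<open>n 0\<close> is the full valence of the root.
\<close>

locale model_tree = infinite_tree E for E :: "'a \<Rightarrow> 'a \<Rightarrow> bool" +
  fixes y0 :: 'a and n :: "nat \<Rightarrow> nat"
  assumes root_valence: "valence E y0 = n 0"
    and sphere_valence: "\<And>r x. r > 0 \<Longrightarrow> x \<in> graph_sphere E y0 r \<Longrightarrow> valence E x = n r + 1"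

definition laplacian :: "('a \<Rightarrow> 'a \<Rightarrow> bool) \<Rightarrow> ('a \<Rightarrow> real) \<Rightarrow> 'a \<Rightarrow> real" where
  "laplacian E f x = (\<Sum>y | E x y. f x - f y)"

text \<open>
  Infinitely differentiable on \<open>[0, \<infinity>)\<close>, with one-sided derivatives at \<open>0\<close>; \<open>D k\<close> is the
  \<open>k\<close>-th derivative.
\<close>

definition smooth_halfline :: "(real \<Rightarrow> real) \<Rightarrow> bool" where
  "smooth_halfline g \<longleftrightarrow>
     (\<exists>D :: nat \<Rightarrow> real \<Rightarrow> real. (\<forall>t\<ge>0. D 0 t = g t) \<and>
        (\<forall>k. \<forall>t\<ge>0. (D k has_real_derivative D (Suc k) t) (at t within {0..})))"

text \<open>
  Kernels are written \<open>p t x y\<close>; their values at \<open>t < 0\<close> are irrelevant.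
  The heat equation is required in each of the two vertex variables.
\<close>

definition heat_solution :: "('a \<Rightarrow> 'a \<Rightarrow> bool) \<Rightarrow> (real \<Rightarrow> 'a \<Rightarrow> 'a \<Rightarrow> real) \<Rightarrow> bool" where
  "heat_solution E p \<longleftrightarrow>
     (\<forall>t\<ge>0. \<forall>x y. p t x y \<ge> 0) \<and>
     (\<forall>x y. smooth_halfline (\<lambda>t. p t x y)) \<and>
     (\<forall>t\<ge>0. \<forall>x y. ((\<lambda>s. p s x y) has_real_derivative - laplacian E (\<lambda>z. p t z y) x)
        (at t within {0..})) \<and>
     (\<forall>t\<ge>0. \<forall>x y. ((\<lambda>s. p s x y) has_real_derivative - laplacian E (\<lambda>z. p t x z) y)
        (at t within {0..})) \<and>
     (\<forall>x y. p 0 x y = (if x = y then 1 else 0))"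

definition is_heat_kernel :: "('a \<Rightarrow> 'a \<Rightarrow> bool) \<Rightarrow> (real \<Rightarrow> 'a \<Rightarrow> 'a \<Rightarrow> real) \<Rightarrow> bool" where
  "is_heat_kernel E p \<longleftrightarrow>
     heat_solution E p \<and>
     (\<forall>q. heat_solution E q \<longrightarrow> (\<forall>t\<ge>0. \<forall>x y. p t x y \<le> q t x y))"

definition radial_kernel ::
  "('a \<Rightarrow> 'a \<Rightarrow> bool) \<Rightarrow> 'a \<Rightarrow> (real \<Rightarrow> 'a \<Rightarrow> 'a \<Rightarrow> real) \<Rightarrow> real \<Rightarrow> nat \<Rightarrow> real" where
  "radial_kernel E y0 p t r = (THE v. \<forall>x \<in> graph_sphere E y0 r. p t y0 x = v)"

end

theory Submission
  imports Defs
begin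

text \<open>
  The heat kernel is the increasing limit of the Dirichlet heat kernels of an exhaustion by balls.
  If \<open>c\<close> bounds the valence on a ball \<open>B\<close>, its Dirichlet kernel is
  \<open>exp (- c * t)\<close> times the exponential series of the non-negative operator \<open>c - \<Delta>\<close> restricted
  to \<open>B\<close>. With the same \<open>c\<close> for the balls of radius \<open>R\<close> in both trees, the two series can be
  compared coefficient by coefficient: on the model tree the coefficients form a decreasing
  function of the distance from the root, and for such a function more branching only lowers
  the average over the neighbours, so no maximum principle is needed.
\<close>

section \<open>Powers of the shifted Laplacian on a set with Dirichlet boundary condition\<close>

text \<open>The \<open>(x, y)\<close> entry of the \<open>k\<close>-th power of
  \<open>c - \<Delta>\<close> restricted to \<open>B\<close>, functions being extended by 0 outside
  \<open>B\<close>. If \<open>c\<close> bounds the valences, it is the total weight of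
  \<open>k\<close>-step walks from \<open>x\<close> to \<open>y\<close> inside \<open>B\<close>,
  where each edge has weight 1 and staying at \<open>z\<close> has weight
  \<open>c - valence E z\<close>.\<close>

primrec killed_walk :: "('a \<Rightarrow> 'a \<Rightarrow> bool) \<Rightarrow> 'a set \<Rightarrow> real \<Rightarrow> nat \<Rightarrow> 'a \<Rightarrow> 'a \<Rightarrow> real" where
  "killed_walk E B c 0 x y = (if x = y \<and> y \<in> B then 1 else 0)"
| "killed_walk E B c (Suc k) x y =
     (if y \<in> B then c * killed_walk E B c k x y - laplacian E (killed_walk E B c k x) y else 0)"

text \<open>The shift by \<open>c\<close> cancels against the exponential factor, so this is the
  kernel of the semigroup generated by \<open>- \<Delta>\<close> on \<open>B\<close>; the choice of
  \<open>c\<close> only changes the coefficients of the series.\<close>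

definition dirichlet_kernel ::
  "('a \<Rightarrow> 'a \<Rightarrow> bool) \<Rightarrow> 'a set \<Rightarrow> real \<Rightarrow> real \<Rightarrow> 'a \<Rightarrow> 'a \<Rightarrow> real" where
  "dirichlet_kernel E B c t x y =
     exp (- c * t) * (\<Sum>k. killed_walk E B c k x y / fact k * t ^ k)"

context infinite_graph
begin

lemma adj_sym: "E x y \<longleftrightarrow> E y x"
  using symmetric by (auto dest: sympD)

lemma laplacian_eq: "laplacian E f x = real (valence E x) * f x - (\<Sum>y | E x y. f y)"
  by (simp add: laplacian_def valence_def sum_subtractf)

lemma killed_walk_outside: "y \<notin> B \<Longrightarrow> killed_walk E B c k x y = 0"
  by (cases k) auto

lemma killed_walk_outside': "x \<notin> B \<Longrightarrow> killed_walk E B c k x y = 0"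
proof (induction k arbitrary: y)
  case (Suc k)
  then have "killed_walk E B c k x = (\<lambda>_. 0)" by auto
  then show ?case by (simp add: laplacian_def)
qed auto

text \<open>The generator acting on the first variable commutes with the one acting on the second.\<close>

lemma killed_walk_Suc_left:
  "killed_walk E B c (Suc k) x y =
     (if x \<in> B then c * killed_walk E B c k x y - laplacian E (\<lambda>z. killed_walk E B c k z y) x else 0)"
proof (induction k arbitrary: x y)
  case 0
  show ?case
  proof (cases "x \<in> B \<and> y \<in> B")
    case True
    have 1: "(\<Sum>z | E y z. if x = z \<and> z \<in> B then 1 else 0) = (if E y x then 1 else (0::real))"
    proof -
      have "(\<Sum>z | E y z. if x = z \<and> z \<in> B then 1 else 0)
          = (\<Sum>z | E y z. if x = z then 1 else (0::real))"
        using True by (intro sum.cong) auto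
      then show ?thesis using locally_finite[of y] by (simp add: sum.delta')
    qed
    have 2: "(\<Sum>z | E x z. if z = y \<and> y \<in> B then 1 else 0) = (if E x y then 1 else (0::real))"
      using True locally_finite[of x] by (simp add: sum.delta)
    show ?thesis
      using True 1 2 by (auto simp: laplacian_eq adj_sym)
  next
    case False
    show ?thesis
    proof (cases "y \<in> B")
      case True
      then have "x \<notin> B" using False by auto
      then show ?thesis
        using killed_walk_outside'[of x B c "Suc 0" y] by (simp del: killed_walk.simps)
    qed (auto simp: laplacian_def)
  qed
next
  case (Suc k)
  let ?W = "killed_walk E B c"
  show ?case
  proof (cases "x \<in> B \<and> y \<in> B")
    case True
    have L: "?W (Suc k) x z = c * ?W k x z - laplacian E (\<lambda>u. ?W k u z) x" for z
      using Suc.IH[of x z] True by auto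
    have R: "?W (Suc k) z y = c * ?W k z y - laplacian E (?W k z) y" for z
      using True by simp
    \<comment> \<open>Both sides expand to one double sum over the neighbours of \<open>x\<close>
      and of \<open>y\<close>, taken in the two orders.\<close>
    have comm: "laplacian E (\<lambda>z. laplacian E (\<lambda>u. ?W k u z) x) y
        = laplacian E (\<lambda>u. laplacian E (?W k u) y) x"
    proof -
      have "laplacian E (\<lambda>z. laplacian E (\<lambda>u. ?W k u z) x) y
          = (\<Sum>z | E y z. \<Sum>u | E x u. (?W k x y - ?W k u y) - (?W k x z - ?W k u z))"
        by (simp only: laplacian_def sum_subtractf)
      also have "\<dots> = (\<Sum>u | E x u. \<Sum>z | E y z. (?W k x y - ?W k x z) - (?W k u y - ?W k u z))"
        by (subst sum.swap) (simp add: algebra_simps)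
      also have "\<dots> = laplacian E (\<lambda>u. laplacian E (?W k u) y) x"
        by (simp only: laplacian_def sum_subtractf)
      finally show ?thesis .
    qed
    have lin: "laplacian E (\<lambda>z. c * f z - g z) u = c * laplacian E f u - laplacian E g u" for f g u
      by (simp add: laplacian_def sum_distrib_left flip: sum_subtractf) (simp add: algebra_simps)
    have "?W (Suc (Suc k)) x y = c * ?W (Suc k) x y - laplacian E (?W (Suc k) x) y"
      using True by simp
    also have "laplacian E (?W (Suc k) x) y
        = c * laplacian E (?W k x) y - laplacian E (\<lambda>z. laplacian E (\<lambda>u. ?W k u z) x) y"
      unfolding L[abs_def] lin ..
    \<comment> \<open>\<open>R\<close> and \<open>L\<close> compute the same entry
      \<open>?W (Suc k) x y\<close>, so the Laplacians of \<open>?W k\<close> in the two variables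
      agree at \<open>(x, y)\<close>.\<close>
    also have "c * laplacian E (?W k x) y = c * (c * ?W k x y - ?W (Suc k) x y)"
      using R[of x] by simp
    also have "\<dots> = c * laplacian E (\<lambda>u. ?W k u y) x"
      using L[of y] by simp
    also have "c * laplacian E (\<lambda>u. ?W k u y) x - laplacian E (\<lambda>z. laplacian E (\<lambda>u. ?W k u z) x) y
        = laplacian E (\<lambda>z. ?W (Suc k) z y) x"
      unfolding R lin comm ..
    finally show ?thesis using True by simp
  next
    case False
    then consider "x \<notin> B" | "y \<notin> B" by auto
    then show ?thesis
    proof cases
      case 1
      then show ?thesis using killed_walk_outside'[OF 1, of c "Suc (Suc k)"] by simp
    next
      case 2
      then show ?thesis by (simp add: laplacian_def)
    qed
  qed
qed

text \<open>By induction the recursion in the second variable at \<open>(x, y)\<close> becomes the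
  recursion in the first variable at \<open>(y, x)\<close>. Symmetry later carries the heat equation
  from one variable to the other.\<close>

lemma killed_walk_sym: "killed_walk E B c k x y = killed_walk E B c k y x"
proof (induction k arbitrary: x y)
  case (Suc k)
  have "killed_walk E B c (Suc k) x y
      = (if y \<in> B then c * killed_walk E B c k y x - laplacian E (\<lambda>z. killed_walk E B c k z x) y else 0)"
    using Suc by (simp add: laplacian_def)
  also have "\<dots> = killed_walk E B c (Suc k) y x"
    by (rule killed_walk_Suc_left[symmetric])
  finally show ?case .
qed auto

section \<open>The Dirichlet heat kernel: bounds, heat equation and minimality\<close>

context
  fixes B :: "'a set" and c :: real
  assumes rate: "\<forall>x\<in>B. real (valence E x) \<le> c" and rate_nonneg: "0 \<le> c"
begin

text \<open>One step combines the values at \<open>y\<close> and at its neighbours with the weights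
  \<open>c - valence E y\<close> and 1, which are nonnegative and add up to
  \<open>c\<close>.\<close>

lemma killed_walk_bounds: "0 \<le> killed_walk E B c k x y \<and> killed_walk E B c k x y \<le> c ^ k"
proof (induction k arbitrary: y)
  case (Suc k)
  show ?case
  proof (cases "y \<in> B")
    case True
    let ?W = "killed_walk E B c k x"
    have eq: "killed_walk E B c (Suc k) x y
        = (c - real (valence E y)) * ?W y + (\<Sum>z | E y z. ?W z)"
      using True by (simp add: laplacian_eq algebra_simps)
    have "(\<Sum>z | E y z. ?W z) \<le> (\<Sum>z | E y z. c ^ k)"
      using Suc.IH by (intro sum_mono) auto
    moreover have "(c - real (valence E y)) * ?W y \<le> (c - real (valence E y)) * c ^ k"
      using Suc.IH bspec[OF rate True] by (intro mult_left_mono) auto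
    moreover have "0 \<le> (c - real (valence E y)) * ?W y"
      using Suc.IH bspec[OF rate True] by simp
    moreover have "0 \<le> (\<Sum>z | E y z. ?W z)"
      using Suc.IH by (intro sum_nonneg) auto
    ultimately show ?thesis
      unfolding eq by (simp add: valence_def algebra_simps)
  qed (auto simp: rate_nonneg)
qed auto

lemma killed_walk_summable: "summable (\<lambda>k. killed_walk E B c k x y / fact k * t ^ k)"
proof (rule summable_comparison_test)
  show "summable (\<lambda>k. (c * \<bar>t\<bar>) ^ k /\<^sub>R fact k)"
    by (rule summable_exp_generic)
  have "norm (killed_walk E B c k x y / fact k * t ^ k) \<le> (c * \<bar>t\<bar>) ^ k /\<^sub>R fact k" for k
  proof -
    have "norm (killed_walk E B c k x y / fact k * t ^ k)
        = killed_walk E B c k x y * (\<bar>t\<bar> ^ k / fact k)"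
      using killed_walk_bounds[of k x y] by (simp add: abs_mult power_abs)
    also have "\<dots> \<le> c ^ k * (\<bar>t\<bar> ^ k / fact k)"
      using killed_walk_bounds[of k x y] by (intro mult_right_mono) auto
    finally show ?thesis by (simp add: power_mult_distrib field_simps)
  qed
  then show "\<exists>N. \<forall>k\<ge>N. norm (killed_walk E B c k x y / fact k * t ^ k) \<le> (c * \<bar>t\<bar>) ^ k /\<^sub>R fact k"
    by blast
qed

text \<open>The coefficients are at most those of \<open>exp (c * t)\<close>. The bound 1 does not
  depend on \<open>B\<close>, which gives both convergence and domination along an
  exhaustion.\<close>

lemma dirichlet_kernel_bounds:
  assumes "0 \<le> t"
  shows "0 \<le> dirichlet_kernel E B c t x y" "dirichlet_kernel E B c t x y \<le> 1"
proof -
  let ?a = "\<lambda>k. killed_walk E B c k x y / fact k * t ^ k"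
  show "0 \<le> dirichlet_kernel E B c t x y"
    unfolding dirichlet_kernel_def
    using killed_walk_bounds assms killed_walk_summable
    by (intro mult_nonneg_nonneg suminf_nonneg) auto
  have "(\<Sum>k. ?a k) \<le> (\<Sum>k. (c * t) ^ k /\<^sub>R fact k)"
  proof (rule suminf_le[OF _ killed_walk_summable summable_exp_generic])
    fix k
    have "?a k \<le> c ^ k / fact k * t ^ k"
      using killed_walk_bounds[of k x y] assms by (intro mult_right_mono divide_right_mono) auto
    then show "?a k \<le> (c * t) ^ k /\<^sub>R fact k"
      by (simp add: power_mult_distrib field_simps)
  qed
  then have "(\<Sum>k. ?a k) \<le> exp (c * t)"
    by (simp add: exp_def)
  then have "dirichlet_kernel E B c t x y \<le> exp (- c * t) * exp (c * t)"
    unfolding dirichlet_kernel_def by (intro mult_left_mono) auto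
  then show "dirichlet_kernel E B c t x y \<le> 1"
    by (simp flip: exp_add)
qed

lemma dirichlet_kernel_sym: "dirichlet_kernel E B c t x y = dirichlet_kernel E B c t y x"
  unfolding dirichlet_kernel_def by (subst killed_walk_sym) simp

lemma dirichlet_kernel_0: "dirichlet_kernel E B c 0 x y = (if x = y \<and> y \<in> B then 1 else 0)"
  unfolding dirichlet_kernel_def powser_zero by simp

text \<open>Differentiating the series shifts its coefficients by one, which applies
  \<open>c - \<Delta>\<close>; the derivative of the exponential factor removes the
  \<open>c\<close>.\<close>

lemma dirichlet_kernel_deriv:
  assumes "y \<in> B"
  shows "((\<lambda>s. dirichlet_kernel E B c s x y) has_real_derivative
            - laplacian E (dirichlet_kernel E B c t x) y) (at t)"
proof -
  let ?a = "\<lambda>z k. killed_walk E B c k x z / fact k"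
  let ?S = "\<lambda>z. \<Sum>k. ?a z k * t ^ k"
  have "(\<lambda>k. ?a z k * t ^ k) sums ?S z" for z
    using killed_walk_summable by (rule summable_sums)
  then have "(\<lambda>k. c * (?a y k * t ^ k) - (\<Sum>z | E y z. ?a y k * t ^ k - ?a z k * t ^ k))
      sums (c * ?S y - laplacian E ?S y)"
    unfolding laplacian_def by (intro sums_diff sums_mult sums_sum)
  moreover have "c * (?a y k * t ^ k) - (\<Sum>z | E y z. ?a y k * t ^ k - ?a z k * t ^ k)
      = diffs (?a y) k * t ^ k" for k
  proof -
    have "diffs (?a y) k = killed_walk E B c (Suc k) x y / fact k"
      by (simp add: diffs_def fact_Suc del: killed_walk.simps of_nat_Suc)
    also have "\<dots> = c * ?a y k - laplacian E (killed_walk E B c k x) y / fact k"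
      using assms by (simp add: diff_divide_distrib)
    finally have d: "diffs (?a y) k = c * ?a y k - laplacian E (killed_walk E B c k x) y / fact k" .
    show ?thesis
      unfolding d laplacian_def
      by (simp add: left_diff_distrib sum_divide_distrib sum_distrib_right diff_divide_distrib)
  qed
  ultimately have S: "(\<Sum>k. diffs (?a y) k * t ^ k) = c * ?S y - laplacian E ?S y"
    by (simp add: sums_iff)
  have "((\<lambda>s. exp (- c * s)) has_real_derivative exp (- c * t) * (- c)) (at t)"
    by (auto intro!: derivative_eq_intros)
  note DERIV_mult[OF this termdiffs_strong_converges_everywhere[OF killed_walk_summable, of x y t]]
  moreover have "exp (- c * t) * (- c) * ?S y + (\<Sum>k. diffs (?a y) k * t ^ k) * exp (- c * t)
      = - laplacian E (dirichlet_kernel E B c t x) y"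
    unfolding S by (simp add: laplacian_def dirichlet_kernel_def sum_distrib_left algebra_simps)
  ultimately show ?thesis
    by (simp add: dirichlet_kernel_def)
qed

text \<open>
  The partial sums of \<open>exp (c * t) * dirichlet_kernel\<close> are the Picard iterates of the heat
  equation, started from \<open>0 \<le> exp (c * t) * v\<close>.
\<close>

lemma dirichlet_kernel_le:
  assumes nonneg: "\<And>t y. 0 \<le> t \<Longrightarrow> 0 \<le> v t y"
    and deriv: "\<And>t y. 0 \<le> t \<Longrightarrow> y \<in> B \<Longrightarrow>
        ((\<lambda>s. v s y) has_real_derivative - laplacian E (v t) y) (at t within {0..})"
    and init: "\<And>y. y \<in> B \<Longrightarrow> (if x = y then 1 else 0) \<le> v 0 y"
    and t: "0 \<le> t"
  shows "dirichlet_kernel E B c t x y \<le> v t y"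
proof -
  let ?W = "killed_walk E B c"
  define S where "S N s z = (\<Sum>k<N. ?W k x z / fact k * s ^ k)" for N s z
  have "S N s z \<le> exp (c * s) * v s z" if "0 \<le> s" for N s z
    using that
  proof (induction N arbitrary: s z)
    case 0
    then show ?case using nonneg by (simp add: S_def)
  next
    case (Suc N)
    show ?case
    proof (cases "z \<in> B")
      case False
      then have "S (Suc N) s z = 0" by (simp add: S_def killed_walk_outside del: killed_walk.simps)
      then show ?thesis using nonneg Suc.prems by simp
    next
      case True
      let ?h = "\<lambda>s. exp (c * s) * v s z - S (Suc N) s z"
      let ?u = "\<lambda>s z. exp (c * s) * v s z - S N s z"
      \<comment> \<open>Differentiation lowers the degree, so only the preceding partial sum
        \<open>S N\<close> appears on the right.\<close>
      have dS: "((\<lambda>s. S (Suc N) s z) has_real_derivative (c * S N r z - laplacian E (S N r) z))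
          (at r within {0..})" for r
      proof -
        have "(\<lambda>s. S (Suc N) s z) = (\<lambda>s. ?W 0 x z + (\<Sum>k<N. ?W (Suc k) x z / fact (Suc k) * s ^ Suc k))"
          unfolding S_def sum.lessThan_Suc_shift by simp
        moreover have "((\<lambda>s. ?W 0 x z + (\<Sum>k<N. ?W (Suc k) x z / fact (Suc k) * s ^ Suc k))
            has_real_derivative (0 + (\<Sum>k<N. ?W (Suc k) x z / fact (Suc k) * (real (Suc k) * r ^ k))))
            (at r within {0..})"
          by (intro DERIV_add DERIV_const DERIV_sum DERIV_cmult)
            (auto intro!: derivative_eq_intros simp del: power_Suc)
        moreover have "(\<Sum>k<N. ?W (Suc k) x z / fact (Suc k) * (real (Suc k) * r ^ k))
            = (\<Sum>k<N. ?W (Suc k) x z / fact k * r ^ k)"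
          by (intro sum.cong) (auto simp: fact_Suc simp del: killed_walk.simps of_nat_Suc)
        moreover have "\<dots> = c * S N r z - laplacian E (S N r) z"
        proof -
          have "(\<Sum>k<N. ?W (Suc k) x z / fact k * r ^ k)
              = (\<Sum>k<N. c * (?W k x z / fact k * r ^ k)
                  - (\<Sum>w | E z w. ?W k x z / fact k * r ^ k - ?W k x w / fact k * r ^ k))"
            using True by (intro sum.cong)
              (auto simp: laplacian_def diff_divide_distrib sum_divide_distrib sum_distrib_right
                left_diff_distrib)
          also have "\<dots> = c * S N r z - laplacian E (S N r) z"
            unfolding S_def laplacian_def sum_subtractf
            by (simp add: sum_distrib_left sum.swap[of _ "{..<N}"])
          finally show ?thesis .
        qed
        ultimately show ?thesis by simp
      qed
      \<comment> \<open>In this form the weights are nonnegative, so the induction hypothesis at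
        \<open>z\<close> and at all its neighbours makes \<open>?h\<close> increasing.\<close>
      have dh: "(?h has_real_derivative
          (c - real (valence E z)) * ?u r z + (\<Sum>w | E z w. ?u r w)) (at r within {0..})"
        if "0 \<le> r" for r
      proof -
        have "(?h has_real_derivative
            (exp (c * r) * (- laplacian E (v r) z) + exp (c * r) * c * v r z)
             - (c * S N r z - laplacian E (S N r) z)) (at r within {0..})"
          by (auto intro!: derivative_eq_intros dS deriv that True)
        moreover have "(exp (c * r) * (- laplacian E (v r) z) + exp (c * r) * c * v r z)
             - (c * S N r z - laplacian E (S N r) z)
           = (c - real (valence E z)) * ?u r z + (\<Sum>w | E z w. ?u r w)"
          by (simp add: laplacian_eq sum_subtractf sum_distrib_left algebra_simps)
        ultimately show ?thesis by simp
      qed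
      have "?h 0 \<le> ?h s"
      proof (rule DERIV_nonneg_imp_increasing_open[OF Suc.prems])
        fix r assume r: "0 < r" "r < s"
        have "(?h has_real_derivative
            (c - real (valence E z)) * ?u r z + (\<Sum>w | E z w. ?u r w)) (at r)"
          using dh[of r] r at_within_interior[of r "{0..}"] by simp
        moreover have "0 \<le> (c - real (valence E z)) * ?u r z + (\<Sum>w | E z w. ?u r w)"
          using Suc.IH[of r] r bspec[OF rate True]
          by (intro add_nonneg_nonneg mult_nonneg_nonneg sum_nonneg) auto
        ultimately show "\<exists>D. (?h has_real_derivative D) (at r) \<and> 0 \<le> D" by blast
      next
        show "continuous_on {0..s} ?h"
          by (rule DERIV_continuous_on, rule DERIV_subset[OF dh]) auto
      qed
      moreover have "0 \<le> ?h 0"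
        using init[OF True] True
        unfolding S_def sum.lessThan_Suc_shift by (simp del: killed_walk.simps(2))
      ultimately show ?thesis by simp
    qed
  qed
  then have "(\<Sum>k. ?W k x y / fact k * t ^ k) \<le> exp (c * t) * v t y"
    using t by (intro suminf_le_const killed_walk_summable) (auto simp: S_def)
  then have "dirichlet_kernel E B c t x y \<le> exp (- c * t) * (exp (c * t) * v t y)"
    unfolding dirichlet_kernel_def by (intro mult_left_mono) auto
  also have "\<dots> = v t y"
    by (simp add: mult.assoc[symmetric] flip: exp_add)
  finally show ?thesis .
qed

end


section \<open>The heat kernel as the limit of Dirichlet kernels along an exhaustion\<close>

text \<open>The heat equation bootstraps: the Laplacian at a vertex is a finite sum, so it may be
  differentiated again, and the \<open>k\<close>-th derivative is \<open>- \<Delta>\<close> applied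
  \<open>k\<close> times.\<close>

lemma smooth_halfline_of_heat_equation:
  assumes "\<And>t y. 0 \<le> t \<Longrightarrow>
      ((\<lambda>s. v s y) has_real_derivative - laplacian E (v t) y) (at t within {0..})"
  shows "smooth_halfline (\<lambda>t. v t y)"
proof -
  define D where "D k t = ((\<lambda>f z. - laplacian E f z) ^^ k) (v t)" for k t
  have "((\<lambda>s. D k s z) has_real_derivative D (Suc k) t z) (at t within {0..})"
    if "0 \<le> t" for k t z
  proof (induction k arbitrary: z)
    case 0
    then show ?case using assms that by (simp add: D_def)
  next
    case (Suc k)
    have "((\<lambda>s. - (\<Sum>w | E z w. D k s z - D k s w)) has_real_derivative
        - (\<Sum>w | E z w. D (Suc k) t z - D (Suc k) t w)) (at t within {0..})"
      by (intro DERIV_minus DERIV_sum DERIV_diff Suc.IH)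
    then show ?case by (simp add: D_def laplacian_def)
  qed
  then show ?thesis
    unfolding smooth_halfline_def
    by (intro exI[of _ "\<lambda>k t. D k t y"]) (simp add: D_def)
qed

context
  fixes B :: "nat \<Rightarrow> 'a set" and c :: "nat \<Rightarrow> real"
  assumes exhaustion: "incseq B" "(\<Union>R. B R) = UNIV"
    and rates: "\<And>R. \<forall>x\<in>B R. real (valence E x) \<le> c R" "\<And>R. 0 \<le> c R"
begin

abbreviation (input) K where "K R \<equiv> dirichlet_kernel E (B R) (c R)"

definition limit_kernel where "limit_kernel t x y = lim (\<lambda>R. K R t x y)"

lemma dirichlet_kernel_le_solution:
  assumes "heat_solution E q" "0 \<le> t"
  shows "K R t x y \<le> q t x y"
proof (rule dirichlet_kernel_le[OF rates, where v = "\<lambda>t. q t x"])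
  show "(if x = z then 1 else 0) \<le> q 0 x z" for z
    using assms(1) unfolding heat_solution_def by simp
qed (use assms in \<open>unfold heat_solution_def, blast+\<close>)

text \<open>The kernel of the larger set solves the heat equation on the smaller one with at least
  the same initial values, so minimality gives monotonicity in \<open>R\<close>; the bound 1 then
  gives convergence.\<close>

lemma dirichlet_kernel_tendsto:
  assumes "0 \<le> t"
  shows "(\<lambda>R. K R t x y) \<longlonglongrightarrow> limit_kernel t x y"
proof -
  have "K R t x y \<le> K (Suc R) t x y" for R
  proof (rule dirichlet_kernel_le[OF rates, where v = "\<lambda>t. K (Suc R) t x"])
    have sub: "B R \<subseteq> B (Suc R)" using exhaustion(1) by (auto simp: incseq_Suc_iff)
    show "((\<lambda>s. K (Suc R) s x z) has_real_derivative - laplacian E (K (Suc R) s x) z)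
        (at s within {0..})" if "z \<in> B R" for s z
      by (rule has_field_derivative_at_within, rule dirichlet_kernel_deriv[OF rates])
         (use that sub in blast)
    show "(if x = z then 1 else 0) \<le> K (Suc R) 0 x z" if "z \<in> B R" for z
      using that sub by (auto simp: dirichlet_kernel_0[OF rates])
  qed (use assms in \<open>simp_all add: dirichlet_kernel_bounds(1)[OF rates]\<close>)
  then have "incseq (\<lambda>R. K R t x y)" by (rule incseq_SucI)
  then obtain l where "(\<lambda>R. K R t x y) \<longlonglongrightarrow> l"
    by (rule incseq_convergent) (use dirichlet_kernel_bounds(2)[OF rates assms] in blast)
  then show ?thesis
    unfolding limit_kernel_def by (simp add: limI)
qed

lemma limit_kernel_sym: "limit_kernel t x y = limit_kernel t y x"
  unfolding limit_kernel_def
  by (intro arg_cong[where f = lim] ext dirichlet_kernel_sym[OF rates])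

lemma limit_kernel_0: "limit_kernel 0 x y = (if x = y then 1 else 0)"
proof -
  obtain N where N: "y \<in> B N" using exhaustion(2) by blast
  have "K R 0 x y = (if x = y then 1 else 0)" if "N \<le> R" for R
    using N that incseqD[OF exhaustion(1) that] by (auto simp: dirichlet_kernel_0[OF rates])
  then have "(\<lambda>R. K R 0 x y) \<longlonglongrightarrow> (if x = y then 1 else 0)"
    by (intro tendsto_eventually eventually_sequentiallyI)
  then show ?thesis
    using dirichlet_kernel_tendsto[of 0 x y] LIMSEQ_unique by blast
qed

text \<open>In integrated form the heat equation passes to the limit by dominated convergence, with
  no control on the convergence of derivatives.\<close>

lemma limit_kernel_integral:
  fixes x y :: 'a and T :: real
  defines "g \<equiv> \<lambda>s. - laplacian E (limit_kernel s x) y"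
  assumes "0 \<le> T"
  shows "g integrable_on {0..T}" "limit_kernel T x y = limit_kernel 0 x y + integral {0..T} g"
proof -
  obtain N where "y \<in> B N" using exhaustion(2) by blast
  \<comment> \<open>After the shift by \<open>N\<close> every set of the sequence contains
    \<open>y\<close>, so the heat equation holds at \<open>y\<close> throughout.\<close>
  then have y: "y \<in> B (R + N)" for R
    using incseqD[OF exhaustion(1), of N "R + N"] by auto
  define f where "f R s = - laplacian E (K (R + N) s x) y" for R s
  have f: "(f R has_integral K (R + N) T x y - K (R + N) 0 x y) {0..T}" for R
    unfolding f_def
    by (rule fundamental_theorem_of_calculus[OF \<open>0 \<le> T\<close>],
        rule has_real_derivative_iff_has_vector_derivative[THEN iffD1],
        rule has_field_derivative_at_within, rule dirichlet_kernel_deriv[OF rates y])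
  \<comment> \<open>All kernel values lie between 0 and 1, so each neighbour contributes at most 1
    to the Laplacian.\<close>
  have bound: "norm (f R s) \<le> real (valence E y)" if "s \<in> {0..T}" for R s
  proof -
    have s: "0 \<le> s" using that by simp
    have "\<bar>K (R + N) s x y - K (R + N) s x z\<bar> \<le> 1" for z
      using dirichlet_kernel_bounds[OF rates s, of "R + N" x y]
        dirichlet_kernel_bounds[OF rates s, of "R + N" x z] by linarith
    then have "\<bar>\<Sum>z | E y z. K (R + N) s x y - K (R + N) s x z\<bar> \<le> (\<Sum>z | E y z. 1)"
      by (intro order_trans[OF sum_abs sum_mono])
    then show ?thesis by (simp add: f_def laplacian_def valence_def)
  qed
  have shift: "(\<lambda>R. K (R + N) s x z) \<longlonglongrightarrow> limit_kernel s x z" if "0 \<le> s" for s z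
    using dirichlet_kernel_tendsto[OF that] by (rule LIMSEQ_ignore_initial_segment)
  have lim: "(\<lambda>R. f R s) \<longlonglongrightarrow> g s" if "s \<in> {0..T}" for s
    unfolding f_def g_def laplacian_def using that
    by (intro tendsto_minus tendsto_sum tendsto_diff shift) auto
  note dc = dominated_convergence[of f "{0..T}" "\<lambda>_. real (valence E y)" g,
      OF has_integral_integrable[OF f] integrable_const_ivl bound lim]
  show "g integrable_on {0..T}" using dc(1) by simp
  have "(\<lambda>R. integral {0..T} (f R)) \<longlonglongrightarrow> limit_kernel T x y - limit_kernel 0 x y"
    unfolding integral_unique[OF f] using assms by (intro tendsto_diff shift) auto
  then show "limit_kernel T x y = limit_kernel 0 x y + integral {0..T} g"
    using dc(2) LIMSEQ_unique by fastforce
qed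

text \<open>The integral equation first shows that the limit is continuous in time; then its
  integrand is continuous and the equation can be differentiated.\<close>

lemma limit_kernel_deriv:
  assumes "0 \<le> t"
  shows "((\<lambda>s. limit_kernel s x y) has_real_derivative - laplacian E (limit_kernel t x) y)
    (at t within {0..})"
proof -
  \<comment> \<open>An endpoint beyond \<open>t\<close> makes the interval a neighbourhood of
    \<open>t\<close> in the half-line, so the two derivatives agree.\<close>
  let ?T = "t + 1"
  let ?g = "\<lambda>s. - laplacian E (limit_kernel s x) y"
  have "continuous_on {0..?T} (\<lambda>s. limit_kernel s x z)" for z
  proof -
    have "continuous_on {0..?T} (\<lambda>s. limit_kernel 0 x z
        + integral {0..s} (\<lambda>s. - laplacian E (limit_kernel s x) z))"
      using assms
      by (intro continuous_on_add continuous_on_const indefinite_integral_continuous_1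
          limit_kernel_integral(1)) simp
    then show ?thesis
      by (rule continuous_on_eq) (rule limit_kernel_integral(2)[symmetric], simp)
  qed
  then have cont: "continuous_on {0..?T} ?g"
    unfolding laplacian_def by (intro continuous_on_minus continuous_on_sum continuous_on_diff)
  have "((\<lambda>s. limit_kernel 0 x y + integral {0..s} ?g) has_real_derivative 0 + ?g t)
      (at t within {0..?T})"
    using assms by (intro DERIV_add DERIV_const integral_has_real_derivative[OF cont]) auto
  then have "((\<lambda>s. limit_kernel s x y) has_real_derivative 0 + ?g t) (at t within {0..?T})"
  proof (rule has_field_derivative_transform_within[where d = 1])
    fix s assume "s \<in> {0..?T}"
    then show "limit_kernel 0 x y + integral {0..s} ?g = limit_kernel s x y"
      by (intro limit_kernel_integral(2)[symmetric]) simp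
  qed (use assms in simp_all)
  moreover have "at t within {0..?T} = at t within {0..}"
    by (rule at_within_nhd[of _ "{..<?T}"]) auto
  ultimately show ?thesis by simp
qed

lemma heat_solution_limit_kernel: "heat_solution E limit_kernel"
  unfolding heat_solution_def
proof (intro conjI allI impI)
  fix x y and t :: real assume t: "0 \<le> t"
  show "0 \<le> limit_kernel t x y"
    by (rule LIMSEQ_le_const[OF dirichlet_kernel_tendsto[OF t]])
       (simp add: dirichlet_kernel_bounds(1)[OF rates t])
  show "((\<lambda>s. limit_kernel s x y) has_real_derivative - laplacian E (\<lambda>z. limit_kernel t z y) x)
      (at t within {0..})"
    using limit_kernel_deriv[OF t, of y x] by (simp add: limit_kernel_sym[of _ _ y])
next
  fix x y
  show "smooth_halfline (\<lambda>t. limit_kernel t x y)"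
    by (rule smooth_halfline_of_heat_equation) (rule limit_kernel_deriv)
qed (simp_all add: limit_kernel_0 limit_kernel_deriv)

text \<open>The limit lies below every solution, hence below \<open>p\<close>; being itself a
  solution, it also lies above the smallest one.\<close>

lemma dirichlet_kernel_tendsto_heat_kernel:
  assumes p: "is_heat_kernel E p" and t: "0 \<le> t"
  shows "(\<lambda>R. K R t x y) \<longlonglongrightarrow> p t x y"
proof -
  have "limit_kernel t x y \<le> p t x y"
    using p dirichlet_kernel_le_solution[OF _ t]
    by (intro LIMSEQ_le_const2[OF dirichlet_kernel_tendsto[OF t]] exI allI impI)
       (simp add: is_heat_kernel_def)
  moreover have "p t x y \<le> limit_kernel t x y"
    using p t heat_solution_limit_kernel by (auto simp: is_heat_kernel_def)
  ultimately show ?thesis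
    using dirichlet_kernel_tendsto[OF t, of x y] by simp
qed

end

section \<open>Distances, balls and spheres\<close>

lemma relpowp_graph_dist: "(E ^^ graph_dist E x y) x y"
  unfolding graph_dist_def using connected rtranclp_imp_relpowp by (metis LeastI_ex)

lemma graph_dist_le: "(E ^^ k) x y \<Longrightarrow> graph_dist E x y \<le> k"
  unfolding graph_dist_def by (rule Least_le)

lemma graph_dist_eq_0_iff: "graph_dist E x y = 0 \<longleftrightarrow> x = y"
  using relpowp_graph_dist[of x y] graph_dist_le[of 0 x y] by auto

lemma graph_dist_adj: "E x z \<Longrightarrow> graph_dist E x y \<le> Suc (graph_dist E z y)"
  by (rule graph_dist_le, rule relpowp_Suc_I2[OF _ relpowp_graph_dist])

lemma graph_dist_Suc:
  assumes "graph_dist E x y = Suc k"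
  obtains z where "E x z" "graph_dist E z y = k"
proof -
  have "(E ^^ Suc k) x y" using relpowp_graph_dist[of x y] assms by simp
  then obtain z where z: "E x z" "(E ^^ k) z y" by (metis relpowp_Suc_D2)
  then have "graph_dist E z y = k"
    using graph_dist_le[OF z(2)] graph_dist_adj[OF z(1), of y] assms by simp
  with z show ?thesis using that by blast
qed

lemma finite_ball: "finite {x. graph_dist E x v \<le> R}"
proof (induction R)
  case 0
  then show ?case by (simp add: graph_dist_eq_0_iff)
next
  case (Suc R)
  have "{x. graph_dist E x v \<le> Suc R}
      \<subseteq> {x. graph_dist E x v \<le> R} \<union> (\<Union>z\<in>{x. graph_dist E x v \<le> R}. {x. E z x})"
    by (auto simp: le_Suc_eq adj_sym elim!: graph_dist_Suc)
  then show ?case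
    using Suc locally_finite by (auto intro: finite_subset)
qed

text \<open>A geodesic meets every smaller distance, so an empty sphere would confine the whole
  graph to a finite ball.\<close>

lemma graph_sphere_nonempty: "graph_sphere E v r \<noteq> {}"
proof
  assume empty: "graph_sphere E v r = {}"
  have "graph_dist E x v \<noteq> r + j" for x j
  proof (induction j arbitrary: x)
    case 0
    then show ?case using empty by (auto simp: graph_sphere_def)
  next
    case (Suc j)
    then show ?case by (metis add_Suc_right graph_dist_Suc)
  qed
  then have "UNIV = {x. graph_dist E x v \<le> r}"
    by (auto simp: not_le_imp_less) (metis le_iff_add nat_le_linear)
  then show False using finite_ball infinite_vertices by metis
qed

lemma min_valence_le: "min_valence E v (graph_dist E x v) \<le> valence E x"
proof -
  have "finite (graph_sphere E v r)" for r
    by (rule finite_subset[OF _ finite_ball[of v r]]) (auto simp: graph_sphere_def)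
  then show ?thesis
    unfolding min_valence_def by (intro Min_le) (auto simp: graph_sphere_def)
qed

end

section \<open>Neighbours in a tree, sorted by their distance from a fixed vertex\<close>

text \<open>Loop erasure: if the vertex to be prepended already occurs, only the tail from that
  occurrence is kept.\<close>

lemma rtranclp_imp_distinct_path:
  assumes "R\<^sup>*\<^sup>* a b"
  obtains xs where "xs \<noteq> []" "distinct xs" "successively R xs" "hd xs = a" "last xs = b"
  using assms
proof (induction arbitrary: thesis rule: converse_rtranclp_induct)
  case base
  then show ?case by (metis distinct_singleton last.simps list.sel(1) list.simps(3) successively.simps(2))
next
  case (step a a')
  obtain xs where xs: "xs \<noteq> []" "distinct xs" "successively R xs" "hd xs = a'" "last xs = b"
    using step.IH by blast
  show ?case
  proof (cases "a \<in> set xs")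
    case True
    then obtain us vs where "xs = us @ a # vs" by (meson split_list)
    then show ?thesis
      using xs by (intro step.prems[of "a # vs"]) (auto simp: successively_append_iff)
  next
    case False
    then show ?thesis
      using xs step.hyps by (intro step.prems[of "a # xs"]) (auto simp: successively_Cons)
  qed
qed

context infinite_tree
begin

text \<open>
  Two neighbours not farther from \<open>v\<close> than \<open>x\<close> are joined to \<open>v\<close> by geodesics avoiding \<open>x\<close>, so a
  simple path between them closes up to a cycle through \<open>x\<close>.
\<close>

lemma closer_neighbour_unique:
  assumes adj: "E x z1" "E x z2"
    and le: "graph_dist E z1 v \<le> graph_dist E x v" "graph_dist E z2 v \<le> graph_dist E x v"
  shows "z1 = z2"
proof (rule ccontr)
  assume neq: "z1 \<noteq> z2"
  define E' where "E' = (\<lambda>u v. E u v \<and> u \<noteq> x \<and> v \<noteq> x)"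
  have irrefl: "\<not> E u u" for u using loopfree by (simp add: irreflp_def)
  have nx: "z1 \<noteq> x" "z2 \<noteq> x" using adj irrefl by auto
  \<comment> \<open>Past its first vertex, a geodesic from \<open>z\<close> to \<open>v\<close> is
    strictly closer to \<open>v\<close> than \<open>x\<close> is, so it avoids
    \<open>x\<close>.\<close>
  have to_v: "E'\<^sup>*\<^sup>* z v" if "graph_dist E z v = k" "k \<le> graph_dist E x v" "z \<noteq> x" for k z
    using that
  proof (induction k arbitrary: z)
    case 0
    then show ?case by (simp add: graph_dist_eq_0_iff)
  next
    case (Suc k)
    obtain w where w: "E z w" "graph_dist E w v = k" using Suc.prems(1) by (rule graph_dist_Suc)
    then have "w \<noteq> x" using Suc.prems(2) by auto
    then have "E' z w" "E'\<^sup>*\<^sup>* w v" using w Suc by (auto simp: E'_def)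
    then show ?case by (rule converse_rtranclp_into_rtranclp)
  qed
  have "symp E'" using symmetric by (auto simp: symp_def E'_def)
  then have "E'\<^sup>*\<^sup>* v z2"
    using to_v[OF refl le(2) nx(2)] by (metis symp_rtranclp sympD)
  with to_v[OF refl le(1) nx(1)] have "E'\<^sup>*\<^sup>* z1 z2" by (rule rtranclp_trans)
  then obtain xs where xs: "xs \<noteq> []" "distinct xs" "successively E' xs" "hd xs = z1" "last xs = z2"
    by (rule rtranclp_imp_distinct_path)
  obtain ys where ys: "xs = z1 # ys" "ys \<noteq> []"
    using xs(1,4,5) neq by (metis last.simps list.collapse)
  have "successively E xs" using xs(3) by (rule successively_mono) (simp add: E'_def)
  moreover have "x \<notin> set xs"
  proof
    assume "x \<in> set xs"
    then obtain us vs where split: "xs = us @ x # vs" by (meson split_list)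
    moreover have "vs \<noteq> []" using split xs(5) nx by auto
    ultimately show False
      using xs(3) by (auto simp: successively_append_iff successively_Cons E'_def)
  qed
  moreover have "3 \<le> length (x # xs)" using ys by (cases ys) auto
  ultimately have "graph_cycle E (x # xs)"
    using xs adj unfolding graph_cycle_def
    by (auto simp: successively_Cons adj_sym)
  then show False using no_cycle by blast
qed

lemma sum_neighbours_root: "(\<Sum>z | E v z. f (graph_dist E z v)) = real (valence E v) * f (Suc 0)"
proof -
  have "graph_dist E z v = Suc 0" if "E v z" for z
  proof -
    have "z \<noteq> v" using that loopfree by (auto simp: irreflp_def)
    moreover have "graph_dist E z v \<le> Suc 0"
      using graph_dist_adj[of z v v] that graph_dist_eq_0_iff[of v v] by (simp add: adj_sym)
    ultimately show ?thesis using graph_dist_eq_0_iff[of z v] by linarith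
  qed
  then have "(\<Sum>z | E v z. f (graph_dist E z v)) = (\<Sum>z | E v z. f (Suc 0))"
    by (intro sum.cong) auto
  then show ?thesis by (simp add: valence_def)
qed

text \<open>One neighbour lies one step closer to \<open>v\<close>. Uniqueness covers equal distance
  as well, so all the others lie exactly one step farther.\<close>

lemma sum_neighbours_Suc:
  assumes r: "graph_dist E x v = Suc s"
  shows "(\<Sum>z | E x z. f (graph_dist E z v)) = f s + (real (valence E x) - 1) * f (Suc (Suc s))"
proof -
  obtain w where w: "E x w" "graph_dist E w v = s" using r by (rule graph_dist_Suc)
  have "graph_dist E z v = Suc (Suc s)" if "E x z" "z \<noteq> w" for z
  proof -
    have "\<not> graph_dist E z v \<le> graph_dist E x v"
      using closer_neighbour_unique[of x z w v] that w r by auto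
    moreover have "graph_dist E z v \<le> Suc (graph_dist E x v)"
      using that adj_sym graph_dist_adj by blast
    ultimately show ?thesis using r by simp
  qed
  then have "(\<Sum>z\<in>{z. E x z} - {w}. f (graph_dist E z v)) = (\<Sum>z\<in>{z. E x z} - {w}. f (Suc (Suc s)))"
    by (intro sum.cong) auto
  also have "\<dots> = (real (valence E x) - 1) * f (Suc (Suc s))"
    using w locally_finite[of x] card_gt_0_iff[of "{z. E x z}"]
    by (auto simp: valence_def card_Diff_singleton of_nat_diff)
  finally show ?thesis
    using sum.remove[of "{z. E x z}" w "\<lambda>z. f (graph_dist E z v)"] w locally_finite[of x] by simp
qed

end

section \<open>Comparison of the coefficients with the radial ones\<close>

text \<open>The recursion of \<open>killed_walk\<close> on the ball of radius \<open>R\<close> in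
  the model tree, for functions of the distance \<open>r\<close> from the root: away from the root
  one neighbour lies inward and \<open>n r\<close> lie outward.\<close>

primrec radial_walk :: "(nat \<Rightarrow> nat) \<Rightarrow> nat \<Rightarrow> real \<Rightarrow> nat \<Rightarrow> nat \<Rightarrow> real" where
  "radial_walk n R c 0 = (\<lambda>r. if r = 0 then 1 else 0)"
| "radial_walk n R c (Suc k) = (\<lambda>r. if r \<le> R then
     (case r of
        0 \<Rightarrow> (c - real (n 0)) * radial_walk n R c k 0 + real (n 0) * radial_walk n R c k (Suc 0)
      | Suc s \<Rightarrow> (c - real (n r) - 1) * radial_walk n R c k r
          + (radial_walk n R c k s + real (n r) * radial_walk n R c k (Suc r)))
     else 0)"

lemma radial_walk_nonneg:
  assumes "\<And>r. r \<le> R \<Longrightarrow> real (n r) + 1 \<le> c"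
  shows "0 \<le> radial_walk n R c k r"
proof (induction k arbitrary: r)
  case (Suc k)
  show ?case
    using Suc assms[of r]
    by (auto split: nat.split intro!: add_nonneg_nonneg mult_nonneg_nonneg)
qed auto

text \<open>The new consecutive differences are nonnegative combinations of the old ones. At the
  root the coefficient is \<open>c - n 0 - 1\<close>, so there \<open>c\<close> must exceed the
  valence \<open>n 0\<close> by at least one.\<close>

lemma radial_walk_decreasing:
  assumes c: "\<And>r. r \<le> R \<Longrightarrow> real (n r) + 1 \<le> c"
  shows "radial_walk n R c k (Suc r) \<le> radial_walk n R c k r"
proof (induction k arbitrary: r)
  case (Suc k)
  let ?w = "radial_walk n R c k"
  show ?case
  proof (cases "Suc r \<le> R")
    case False
    \<comment> \<open>Across the boundary of the ball the next value is 0, so nonnegativity is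
      enough.\<close>
    then have "radial_walk n R c (Suc k) (Suc r) = 0" by simp
    moreover have "0 \<le> radial_walk n R c (Suc k) r" by (rule radial_walk_nonneg) (rule c)
    ultimately show ?thesis by linarith
  next
    case True
    have a: "0 \<le> (c - real (n r) - 1) * (?w r - ?w (Suc r))"
      using Suc[of r] c[of r] True by simp
    have b: "0 \<le> real (n (Suc r)) * (?w (Suc r) - ?w (Suc (Suc r)))"
      using Suc[of "Suc r"] by simp
    show ?thesis
    proof (cases r)
      case 0
      then show ?thesis using a b True by (simp add: algebra_simps)
    next
      case (Suc s)
      then have "?w r \<le> ?w s" using Suc.IH[of s] by simp
      then show ?thesis using a b True Suc by (simp add: algebra_simps)
    qed
  qed
qed auto

text \<open>By induction the sum over neighbours depends only on the distance from the root. This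
  also shows that the heat kernel from the root is radial.\<close>

lemma (in model_tree) killed_walk_eq_radial_walk:
  "killed_walk E {z. graph_dist E z y0 \<le> R} c k y0 y = radial_walk n R c k (graph_dist E y y0)"
proof (induction k arbitrary: y)
  case 0
  show ?case
    using graph_dist_eq_0_iff[of y y0] by (cases "y = y0") simp_all
next
  case (Suc k)
  show ?case
  proof (cases "graph_dist E y y0")
    case 0
    then have "y = y0" by (simp add: graph_dist_eq_0_iff)
    then show ?thesis
      using 0 by (simp add: laplacian_eq Suc sum_neighbours_root root_valence algebra_simps)
  next
    case s: (Suc s)
    have "valence E y = n (Suc s) + 1"
      using sphere_valence[of "Suc s" y] s by (simp add: graph_sphere_def)
    then show ?thesis
      using s by (simp add: laplacian_eq Suc sum_neighbours_Suc algebra_simps)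
  qed
qed

text \<open>The weights are nonnegative, so the induction hypothesis can be inserted. Each branch
  beyond the number in the model tree then moves one unit of weight from distance \<open>r\<close>
  to \<open>r + 1\<close>, where \<open>radial_walk\<close> is no larger.\<close>

lemma (in infinite_tree) killed_walk_le_radial_walk:
  assumes c: "\<And>r. r \<le> R \<Longrightarrow> real (n r) + 1 \<le> c"
    and rate: "\<And>x. graph_dist E x x0 \<le> R \<Longrightarrow> real (valence E x) \<le> c"
    and root: "n 0 \<le> valence E x0"
    and val: "\<And>x. x \<noteq> x0 \<Longrightarrow> n (graph_dist E x x0) + 1 \<le> valence E x"
  shows "killed_walk E {z. graph_dist E z x0 \<le> R} c k x0 x \<le> radial_walk n R c k (graph_dist E x x0)"
proof (induction k arbitrary: x)
  case 0
  then show ?case by (auto simp: graph_dist_eq_0_iff)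
next
  case (Suc k)
  let ?w = "radial_walk n R c k" and ?d = "\<lambda>z. graph_dist E z x0"
  let ?W = "killed_walk E {z. ?d z \<le> R} c k x0"
  show ?case
  proof (cases "?d x \<le> R")
    case True
    have "killed_walk E {z. ?d z \<le> R} c (Suc k) x0 x
        = (c - real (valence E x)) * ?W x + (\<Sum>z | E x z. ?W z)"
      using True by (simp add: laplacian_eq algebra_simps)
    also have "\<dots> \<le> (c - real (valence E x)) * ?w (?d x) + (\<Sum>z | E x z. ?w (?d z))"
      using rate[OF True] Suc by (intro add_mono mult_left_mono sum_mono) auto
    also have "\<dots> \<le> radial_walk n R c (Suc k) (?d x)"
    proof (cases "?d x")
      case 0
      then have "x = x0" by (simp add: graph_dist_eq_0_iff)
      moreover have "0 \<le> (real (valence E x0) - real (n 0)) * (?w 0 - ?w (Suc 0))"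
        using radial_walk_decreasing[OF c] root by simp
      ultimately show ?thesis
        using 0 by (simp add: sum_neighbours_root algebra_simps)
    next
      case s: (Suc s)
      then have "x \<noteq> x0" using graph_dist_eq_0_iff[of x x0] by auto
      then have "0 \<le> (real (valence E x) - 1 - real (n (Suc s))) * (?w (Suc s) - ?w (Suc (Suc s)))"
        using radial_walk_decreasing[OF c] val[of x] s by simp
      then show ?thesis
        using s True by (simp add: sum_neighbours_Suc algebra_simps)
    qed
    finally show ?thesis .
  next
    case False
    then show ?thesis by simp
  qed
qed

section \<open>Comparison of the heat kernels\<close>

text \<open>The condition at radius 0 is forced by short times: at the root the kernels start as
  \<open>1 - valence E x0 * t\<close> and \<open>1 - n 0 * t\<close> to first order.\<close>

theorem theorem3p5p2:
  fixes E :: "'a \<Rightarrow> 'a \<Rightarrow> bool" and x0 :: 'a and p :: "real \<Rightarrow> 'a \<Rightarrow> 'a \<Rightarrow> real"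
    and F :: "'b \<Rightarrow> 'b \<Rightarrow> bool" and y0 :: 'b and n :: "nat \<Rightarrow> nat"
    and q :: "real \<Rightarrow> 'b \<Rightarrow> 'b \<Rightarrow> real"
  assumes "infinite_tree E"
    and "is_heat_kernel E p"
    and "model_tree F y0 n"
    and "is_heat_kernel F q"
    and "\<And>r. r > 0 \<Longrightarrow> int (n r) \<le> int (min_valence E x0 r) - 1"
    and "n 0 \<le> valence E x0"
  shows "\<forall>r. \<forall>x \<in> graph_sphere E x0 r. \<forall>t\<ge>0. p t x0 x \<le> radial_kernel F y0 q t r"
proof (intro allI ballI impI)
  fix r x and t :: real
  assume x: "x \<in> graph_sphere E x0 r" and t: "0 \<le> t"
  interpret T: infinite_tree E by fact
  interpret M: model_tree F y0 n by fact
  define B where "B R = {z. graph_dist E z x0 \<le> R}" for R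
  define C where "C R = {z. graph_dist F z y0 \<le> R}" for R
  \<comment> \<open>A crude common bound: the sums over the finite balls dominate every valence in
    either ball, and the last sum dominates each \<open>n r + 1\<close>. The same \<open>c\<close>
    in both trees makes the two series comparable term by term.\<close>
  define c where "c R = (\<Sum>z\<in>B R. real (valence E z)) + (\<Sum>z\<in>C R. real (valence F z))
    + (\<Sum>r\<le>R. real (n r) + 1)" for R
  have fin: "finite (B R)" "finite (C R)" for R
    by (auto simp: B_def C_def T.finite_ball M.finite_ball)
  have nonneg: "0 \<le> (\<Sum>z\<in>B R. real (valence E z))" "0 \<le> (\<Sum>z\<in>C R. real (valence F z))"
      "0 \<le> (\<Sum>r\<le>R. real (n r) + 1)" for R
    by (auto intro!: sum_nonneg)
  have cB: "\<forall>z\<in>B R. real (valence E z) \<le> c R" for R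
    using member_le_sum[of _ "B R" "\<lambda>z. real (valence E z)"] fin nonneg[of R]
    by (fastforce simp: c_def)
  have cC: "\<forall>z\<in>C R. real (valence F z) \<le> c R" for R
    using member_le_sum[of _ "C R" "\<lambda>z. real (valence F z)"] fin nonneg[of R]
    by (fastforce simp: c_def)
  have cn: "real (n s) + 1 \<le> c R" if "s \<le> R" for s R
    using member_le_sum[of s "{..R}" "\<lambda>r. real (n r) + 1"] that nonneg[of R] by (simp add: c_def)
  have c0: "0 \<le> c R" for R using nonneg[of R] by (simp add: c_def)
  have exB: "incseq B" "(\<Union>R. B R) = UNIV" and exC: "incseq C" "(\<Union>R. C R) = UNIV"
    by (auto simp: B_def C_def incseq_def)
  have val: "n (graph_dist E z x0) + 1 \<le> valence E z" if "z \<noteq> x0" for z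
    using assms(5)[of "graph_dist E z x0"] T.min_valence_le[of x0 z] that T.graph_dist_eq_0_iff[of z x0]
    by linarith
  note limE = T.dirichlet_kernel_tendsto_heat_kernel[OF exB cB c0 assms(2) t]
  note limF = M.dirichlet_kernel_tendsto_heat_kernel[OF exC cC c0 assms(4) t]
  have le: "p t x0 x \<le> q t y0 y" if y: "y \<in> graph_sphere F y0 r" for y
  proof (rule LIMSEQ_le[OF limE limF], intro exI allI impI)
    fix R
    \<comment> \<open>Both vertices are at distance \<open>r\<close>, so \<open>radial_walk\<close>
      at \<open>r\<close> bounds the left side and equals the right side.\<close>
    have "killed_walk E (B R) (c R) k x0 x \<le> killed_walk F (C R) (c R) k y0 y" for k
      using T.killed_walk_le_radial_walk[of R n "c R" x0 k x] cn cB assms(6) val x y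
      by (simp add: B_def C_def M.killed_walk_eq_radial_walk graph_sphere_def)
    then show "dirichlet_kernel E (B R) (c R) t x0 x \<le> dirichlet_kernel F (C R) (c R) t y0 y"
      unfolding dirichlet_kernel_def using t T.killed_walk_summable[OF cB c0] M.killed_walk_summable[OF cC c0]
      by (intro mult_left_mono suminf_le mult_right_mono divide_right_mono) auto
  qed
  \<comment> \<open>Each approximating kernel is radial, hence so is the limit; with a nonempty
    sphere this makes the description in \<open>radial_kernel\<close> definite.\<close>
  have radial: "q t y0 y = q t y0 y'" if "y \<in> graph_sphere F y0 r" "y' \<in> graph_sphere F y0 r" for y y'
  proof -
    have "dirichlet_kernel F (C R) (c R) t y0 y = dirichlet_kernel F (C R) (c R) t y0 y'" for R
      using that by (simp add: dirichlet_kernel_def C_def M.killed_walk_eq_radial_walk graph_sphere_def)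
    then show ?thesis using limF[of y0 y] limF[of y0 y'] LIMSEQ_unique by simp
  qed
  obtain y where y: "y \<in> graph_sphere F y0 r" using M.graph_sphere_nonempty by blast
  have "radial_kernel F y0 q t r = q t y0 y"
    unfolding radial_kernel_def
  proof (rule the_equality)
    show "\<forall>z\<in>graph_sphere F y0 r. q t y0 z = q t y0 y" using radial y by blast
  qed (use y in auto)
  then show "p t x0 x \<le> radial_kernel F y0 q t r" using le[OF y] by simp
qed

end
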